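(* Suppose $a,b,c>0$ are (finite) integers. In Twyst-off extended to allow stacks of size $\infty$: 1. $(\infty,a,\infty)$ is $P$ if and only if $a=1$. 2. $(\infty,a,b,\infty)$ is $P$ if and only if $(a,b)=(x+1,y+1)$ for some pair $(x,y)$ of nonnegative integers that is a $P$ position for Wythoff's game. 3. $(\infty,a,b,c,\infty)$ is $P$ if and only if $a=c>1$.
   Context: Twyst-off with infinite stacks is a two-player impartial game (players alternate; normal play: the last player to move legally wins). A position is a finite ordered sequence of stacks, each stack size being a nonnegative integer or the symbol $\infty$. Positions are subject to the identifications: an end stack of size $0$ is deleted; an interior stack of size $0$ is deleted and its two neighbors $x,y$ are combined into one stack of size $x+y$, where the sum is $\infty$ if $x$ or $y$ is $\infty$. From a position with all stacks nonzero, a move is one of: (i) remove $k\ge1$ tiles from a finite first or last stack; (ii) reduce a first or last stack of size $\infty$ to any finite size (including $0$); (iii) remove the same number $k\ge 1$ of tiles from two consecutive finite stacks; (iv) reduce two consecutive stacks $(\infty,\infty)$ to $(a,a)$ for some finite $a\ge0$; (v) reduce two consecutive stacks $(\infty,b)$ or $(b,\infty)$, with $b$ finite, to $(\infty,b')$ or $(b',\infty)$ respectively, for some $0\le b'<b$. After a move the identifications are applied. Every play is finite. A position is $P$ if the second player can force a win (no option is $P$), and $N$ if the first player can force a win (some option is $P$). Wythoff's game is played on an ordered pair $(x,y)$ of nonnegative integers; a move subtracts a positive integer from one entry or the same positive integer from both entries (entries staying nonnegative), and the last player to move wins. Its $P$ positions are $(0,0)$ and the pairs $(\lfloor n\phi\rfloor,\lfloor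 n\phi^2\rfloor)$, $(\lfloor n\phi^2\rfloor,\lfloor n\phi\rfloor)$ for $n\ge 1$, where $\phi=\frac{1+\sqrt5}{2}$. *)

theory Defs
  imports "HOL-Library.Extended_Nat"
begin

(* The least fixed point expresses forced wins in finitely many moves; on positions from which
   every play is finite, exactly one of the two predicates holds (lemma n_position_iff). *)
inductive p_position :: "('a \<Rightarrow> 'a \<Rightarrow> bool) \<Rightarrow> 'a \<Rightarrow> bool"
  and n_position :: "('a \<Rightarrow> 'a \<Rightarrow> bool) \<Rightarrow> 'a \<Rightarrow> bool"
  for move :: "'a \<Rightarrow> 'a \<Rightarrow> bool"
where
  p_position: "(\<And>q. move p q \<Longrightarrow> n_position move q) \<Longrightarrow> p_position move p"
| n_position: "move p q \<Longrightarrow> p_position move q \<Longrightarrow> n_position move p"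

lemma n_position_iff:
  assumes wf: "wfP (\<lambda>q p. move p q)"
  shows "n_position move p \<longleftrightarrow> \<not> p_position move p"
proof (induction p rule: wfp_induct_rule[OF wf])
  case (1 p)
  then show ?case
    by (metis n_position n_position.cases p_position p_position.cases)
qed

inductive wythoff_move :: "nat \<times> nat \<Rightarrow> nat \<times> nat \<Rightarrow> bool"
where
  fst: "0 < k \<Longrightarrow> k \<le> x \<Longrightarrow> wythoff_move (x, y) (x - k, y)"
| snd: "0 < k \<Longrightarrow> k \<le> y \<Longrightarrow> wythoff_move (x, y) (x, y - k)"
| both: "0 < k \<Longrightarrow> k \<le> x \<Longrightarrow> k \<le> y \<Longrightarrow> wythoff_move (x, y) (x - k, y - k)"

inductive identify_step :: "enat list \<Rightarrow> enat list \<Rightarrow> bool"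
where
  first: "identify_step (0 # s) s"
| last: "identify_step (s @ [0]) s"
| interior: "identify_step (s @ [x, 0, y] @ t) (s @ [x + y] @ t)"

definition identify :: "enat list \<Rightarrow> enat list \<Rightarrow> bool"
  where "identify s t \<longleftrightarrow> identify_step\<^sup>*\<^sup>* s t \<and> 0 \<notin> set t"

(* Moves before the identifications are applied.  In a one-stack position the stack is both
   first and last. *)
inductive reduce_stacks :: "enat list \<Rightarrow> enat list \<Rightarrow> bool"
where
  first_fin: "0 < k \<Longrightarrow> k \<le> a \<Longrightarrow> reduce_stacks (enat a # s) (enat (a - k) # s)"
| last_fin: "0 < k \<Longrightarrow> k \<le> a \<Longrightarrow> reduce_stacks (s @ [enat a]) (s @ [enat (a - k)])"
| first_inf: "reduce_stacks (\<infinity> # s) (enat a # s)"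
| last_inf: "reduce_stacks (s @ [\<infinity>]) (s @ [enat a])"
| fin_fin: "0 < k \<Longrightarrow> k \<le> a \<Longrightarrow> k \<le> b \<Longrightarrow>
    reduce_stacks (s @ [enat a, enat b] @ t) (s @ [enat (a - k), enat (b - k)] @ t)"
| inf_inf: "reduce_stacks (s @ [\<infinity>, \<infinity>] @ t) (s @ [enat a, enat a] @ t)"
| inf_fin: "b' < b \<Longrightarrow> reduce_stacks (s @ [\<infinity>, enat b] @ t) (s @ [\<infinity>, enat b'] @ t)"
| fin_inf: "b' < b \<Longrightarrow> reduce_stacks (s @ [enat b, \<infinity>] @ t) (s @ [enat b', \<infinity>] @ t)"

(* A position is represented by its unique list without zero stacks (lemmas identify_exists and
   identify_unique); lists containing a zero stack are not positions and have no moves. *)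
definition twyst_off_move :: "enat list \<Rightarrow> enat list \<Rightarrow> bool"
  where "twyst_off_move p q \<longleftrightarrow> 0 \<notin> set p \<and> (\<exists>r. reduce_stacks p r \<and> identify r q)"

lemma identify_exists: "\<exists>t. identify s t"
proof (induction s rule: length_induct)
  case (1 s)
  show ?case
  proof (cases "0 \<in> set s")
    case False
    then show ?thesis by (auto simp: identify_def)
  next
    case True
    then obtain u v where s: "s = u @ 0 # v" by (auto dest: split_list)
    have "\<exists>t. identify_step s t \<and> length t < length s"
    proof (cases u rule: rev_cases)
      case Nil
      then show ?thesis using s identify_step.first by fastforce
    next
      case u: (snoc u' x)
      show ?thesis
      proof (cases v)
        case Nil
        then show ?thesis using s identify_step.last by fastforce
      next
        case (Cons y v')
        then show ?thesis using s u identify_step.interior[of u' x y v'] by fastforce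
      qed
    qed
    with 1 show ?thesis
      by (meson identify_def converse_rtranclp_into_rtranclp)
  qed
qed

fun push_stack :: "enat \<Rightarrow> enat list \<Rightarrow> enat list"
where
  "push_stack x [] = (if x = 0 then [] else [x])"
| "push_stack x [z] = [x, z]"
| "push_stack x (z # y # t) = (if z = 0 then (x + y) # t else x # z # y # t)"

abbreviation push_stacks :: "enat list \<Rightarrow> enat list"
  where "push_stacks s \<equiv> foldr push_stack s []"

definition drop_zero :: "enat list \<Rightarrow> enat list"
  where "drop_zero s = (case s of [] \<Rightarrow> [] | x # t \<Rightarrow> if x = 0 then t else s)"

lemma push_stacks_shape:
  "0 \<notin> set (push_stacks s) \<or> (\<exists>y t. push_stacks s = 0 # y # t \<and> 0 \<notin> set (y # t))"
proof (induction s)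
  case (Cons x s)
  then show ?case
    by (cases "push_stacks s" rule: remdups_adj.cases) auto
qed simp

lemma push_stack_nonzero: "z \<noteq> 0 \<Longrightarrow> push_stack x (z # s) = x # z # s"
  by (cases s) auto

lemma drop_zero_identify_step:
  assumes "identify_step s t"
  shows "drop_zero (push_stacks s) = drop_zero (push_stacks t)"
  using assms
proof cases
  case first
  show ?thesis
    using push_stacks_shape[of t] unfolding first
    by (cases "push_stacks t" rule: remdups_adj.cases)
      (auto simp: drop_zero_def)
next
  case last
  then show ?thesis by simp
next
  case (interior u x y v)
  have "push_stack x (push_stack 0 (push_stack y (push_stacks v))) =
      push_stack (x + y) (push_stacks v)"
    using push_stacks_shape[of v]
    by (cases "push_stacks v" rule: remdups_adj.cases)
      (auto simp: add.assoc push_stack_nonzero)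
  then show ?thesis using interior by simp
qed

lemma push_stacks_nonzero: "0 \<notin> set s \<Longrightarrow> push_stacks s = s"
proof (induction s)
  case (Cons x s)
  then show ?case
    by (cases s rule: remdups_adj.cases) auto
qed simp

lemma identify_unique:
  assumes "identify s t" "identify s t'"
  shows "t = t'"
proof -
  have "u = drop_zero (push_stacks s)" if "identify s u" for u
  proof -
    have "identify_step\<^sup>*\<^sup>* s u" and u: "0 \<notin> set u"
      using that by (auto simp: identify_def)
    from this(1) have "drop_zero (push_stacks s) = drop_zero (push_stacks u)"
      by induction (simp_all add: drop_zero_identify_step)
    also have "\<dots> = u"
      using u by (auto simp: push_stacks_nonzero drop_zero_def split: list.splits)
    finally show ?thesis by simp
  qed
  with assms show ?thesis by blast
qed

definition inf_count :: "enat list \<Rightarrow> nat"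
  where "inf_count s = (\<Sum>x\<leftarrow>s. if x = \<infinity> then 1 else 0)"

definition fin_sum :: "enat list \<Rightarrow> nat"
  where "fin_sum s = (\<Sum>x\<leftarrow>s. if x = \<infinity> then 0 else the_enat x)"

abbreviation (input) smaller :: "(enat list \<times> enat list) set"
  where "smaller \<equiv> inv_image (less_than <*lex*> less_than) (\<lambda>s. (inf_count s, fin_sum s))"

lemma identify_smaller:
  assumes "identify_step\<^sup>*\<^sup>* s t"
  shows "inf_count t < inf_count s \<or> inf_count t = inf_count s \<and> fin_sum t \<le> fin_sum s"
  using assms
proof induction
  case (step t u)
  have "inf_count u < inf_count t \<or> inf_count u = inf_count t \<and> fin_sum u \<le> fin_sum t"
    using step(2)
  proof cases
    case (interior v x y w)
    then show ?thesis
      by (cases x; cases y) (auto simp: inf_count_def fin_sum_def zero_enat_def)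
  qed (auto simp: inf_count_def fin_sum_def zero_enat_def)
  with step(3) show ?case by linarith
qed simp

lemma twyst_off_terminates: "wfP (\<lambda>q p. twyst_off_move p q)"
proof -
  have "(q, p) \<in> smaller" if move: "twyst_off_move p q" for p q
  proof -
    obtain r where r: "reduce_stacks p r" "identify_step\<^sup>*\<^sup>* r q"
      using move by (auto simp: twyst_off_move_def identify_def)
    from r(1) have "inf_count r < inf_count p \<or> inf_count r = inf_count p \<and> fin_sum r < fin_sum p"
      by cases (auto simp: inf_count_def fin_sum_def)
    with identify_smaller[OF r(2)] show ?thesis by auto
  qed
  then have "{(q, p). twyst_off_move p q} \<subseteq> smaller" by auto
  moreover have "wf smaller" by (intro wf_inv_image wf_lex_prod wf_less_than)
  ultimately show ?thesis unfolding wfp_def by (rule wf_subset[rotated])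
qed

end

(* A position with finite stacks followed by a single infinite end stack is always N, by a
   pigeonhole argument.  Hence from (oo, s, oo) with s finite a player never profits from reducing
   an infinite stack, and only the moves inside s matter, where emptying the first stack of s
   also removes its neighbour, which merges with the infinite stack (likewise at the end).
   For s = (a, b) the surviving moves are those of Wythoff's game on (a - 1, b - 1), since
   emptying a or b leads to (oo, oo), which is N.  For s = (a, b, c) the answer to a \<noteq> c is to
   make the two outer stacks equal, and the answer to an outer stack of size 1 is to empty the
   opposite outer stack, leaving (oo, 1, oo). *)

theory Submission
  imports Defs
begin

section \<open>Recursion for P positions and computed normal forms\<close>

lemma p_position_iff:
  assumes "wfP (\<lambda>q p. move p q)"
  shows "p_position move p \<longleftrightarrow> (\<forall>q. move p q \<longrightarrow> \<not> p_position move q)"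
  by (metis assms n_position n_position_iff p_position)

text \<open>A computable version of \<open>identify\<close>: folding from the right leaves at most
  one zero, at the head, which \<open>drop_zero\<close> deletes. Being a function, it can be
  evaluated by the simplifier on explicit lists.\<close>

definition normal_form :: "enat list \<Rightarrow> enat list"
  where "normal_form s = drop_zero (push_stacks s)"

lemma identify_iff: "identify s t \<longleftrightarrow> t = normal_form s"
proof -
  have "u = normal_form s" if "identify s u" for u
  proof -
    have "identify_step\<^sup>*\<^sup>* s u" and u: "0 \<notin> set u"
      using that by (auto simp: identify_def)
    from this(1) have "normal_form s = normal_form u"
      by induction (simp_all add: normal_form_def drop_zero_identify_step)
    then show ?thesis
      using u by (auto simp: normal_form_def push_stacks_nonzero drop_zero_def split: list.splits)
  qed
  then show ?thesis using identify_exists by metis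
qed

lemma normal_form_identify_step: "identify_step s t \<Longrightarrow> normal_form s = normal_form t"
  by (simp add: normal_form_def drop_zero_identify_step)

lemma normal_form_nonzero: "0 \<notin> set s \<Longrightarrow> normal_form s = s"
  using identify_iff[of s s] by (simp add: identify_def)

lemma zero_notin_normal_form: "0 \<notin> set (normal_form s)"
  using identify_iff[of s "normal_form s"] by (simp add: identify_def)

abbreviation P :: "enat list \<Rightarrow> bool"
  where "P \<equiv> p_position twyst_off_move"

lemma P_iff:
  assumes "0 \<notin> set p"
  shows "P p \<longleftrightarrow> (\<forall>r. reduce_stacks p r \<longrightarrow> \<not> P (normal_form r))"
  using assms
  by (subst p_position_iff[OF twyst_off_terminates]) (auto simp: twyst_off_move_def identify_iff)

section \<open>Symmetry under reversal\<close>

lemma identify_step_rev: "identify_step s t \<Longrightarrow> identify_step (rev s) (rev t)"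
proof (induction rule: identify_step.induct)
  case (interior s x y t)
  then show ?case
    using identify_step.interior[of "rev t" y x "rev s"] by (simp add: add.commute)
qed (auto intro: identify_step.intros)

text \<open>The fold itself is one-sided, so the symmetry is taken from
  \<open>identify_step\<close>, whose rules are closed under reversal, and carried over by
  uniqueness of the result.\<close>

lemma normal_form_rev: "normal_form (rev s) = rev (normal_form s)"
proof -
  have "identify_step\<^sup>*\<^sup>* s (normal_form s)"
    using identify_iff[of s "normal_form s"] by (simp add: identify_def)
  then have "identify_step\<^sup>*\<^sup>* (rev s) (rev (normal_form s))"
    by induction (auto intro: identify_step_rev rtranclp.rtrancl_into_rtrancl)
  then have "identify (rev s) (rev (normal_form s))"
    using zero_notin_normal_form by (simp add: identify_def)
  then show ?thesis by (simp add: identify_iff)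
qed

lemma reduce_stacks_rev: "reduce_stacks s t \<Longrightarrow> reduce_stacks (rev s) (rev t)"
proof (induction rule: reduce_stacks.induct)
  case (fin_fin k a b s t)
  then show ?case using reduce_stacks.fin_fin[of k b a "rev t" "rev s"] by simp
next
  case (inf_inf s t a)
  then show ?case using reduce_stacks.inf_inf[of "rev t" "rev s" a] by simp
next
  case (inf_fin b' b s t)
  then show ?case using reduce_stacks.fin_inf[of b' b "rev t" "rev s"] by simp
next
  case (fin_inf b' b s t)
  then show ?case using reduce_stacks.inf_fin[of b' b "rev t" "rev s"] by simp
qed (auto intro: reduce_stacks.intros)

lemma twyst_off_move_rev: "twyst_off_move p q \<Longrightarrow> twyst_off_move (rev p) (rev q)"
  unfolding twyst_off_move_def identify_iff
  using reduce_stacks_rev normal_form_rev by (metis set_rev)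

lemma P_rev_iff: "P (rev s) \<longleftrightarrow> P s"
proof (induction s rule: wfp_induct_rule[OF twyst_off_terminates])
  case (1 s)
  have "P (rev s) \<longleftrightarrow> (\<forall>q. twyst_off_move (rev s) (rev q) \<longrightarrow> \<not> P (rev q))"
    by (subst p_position_iff[OF twyst_off_terminates]) (metis rev_rev_ident)
  also have "\<dots> \<longleftrightarrow> (\<forall>q. twyst_off_move s q \<longrightarrow> \<not> P q)"
    using 1 twyst_off_move_rev by (metis rev_rev_ident)
  also have "\<dots> \<longleftrightarrow> P s"
    using p_position_iff[OF twyst_off_terminates] by metis
  finally show ?case .
qed

section \<open>Finite stacks followed by a single infinite stack\<close>

text \<open>A nonzero last stack is never deleted, so the zeros of \<open>u\<close> can be removed
  by steps that do not depend on \<open>z\<close>. Hence one \<open>s\<close> and one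
  \<open>m\<close> serve all \<open>z\<close>, where \<open>m\<close> collects what merges into the
  last stack. This uniformity makes different last stacks comparable in the pigeonhole
  argument.\<close>

lemma normal_form_snoc:
  assumes "\<infinity> \<notin> set u"
  obtains s m where "0 \<notin> set s" and "\<infinity> \<notin> set s"
    and "\<And>z. z \<noteq> 0 \<Longrightarrow> normal_form (u @ [z]) = s @ [z + enat m]"
proof -
  have "\<exists>s m. 0 \<notin> set s \<and> \<infinity> \<notin> set s \<and> (\<forall>z. z \<noteq> 0 \<longrightarrow> normal_form (u @ [z]) = s @ [z + enat m])"
    using assms
  proof (induction u rule: length_induct)
    case (1 u)
    show ?case
    proof (cases "0 \<in> set u")
      case False
      then have "\<forall>z. z \<noteq> 0 \<longrightarrow> normal_form (u @ [z]) = u @ [z + enat 0]"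
        by (simp add: normal_form_nonzero flip: zero_enat_def)
      with False 1(2) show ?thesis by blast
    next
      case True
      then obtain u1 v where u: "u = u1 @ 0 # v" by (auto dest: split_list)
      \<comment> \<open>One identification valid for all \<open>z\<close> at once; \<open>n\<close>
        is 0 unless the zero stands between a stack and the last stack, and then \<open>n\<close> is
        the size of that stack.\<close>
      have "\<exists>u' n. length u' < length u \<and> \<infinity> \<notin> set u' \<and>
        (\<forall>z. identify_step (u @ [z]) (u' @ [z + enat n]))"
      proof (cases u1 rule: rev_cases)
        case Nil
        have "\<forall>z. identify_step (u @ [z]) (v @ [z + enat 0])"
          using u Nil identify_step.first by (simp flip: zero_enat_def)
        then show ?thesis using u 1(2) by (intro exI[of _ v] exI[of _ 0]) auto
      next
        case u1: (snoc u2 x)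
        show ?thesis
        proof (cases v)
          case Nil
          obtain n where n: "x = enat n" using 1(2) u u1 by (cases x) auto
          have "\<forall>z. identify_step (u @ [z]) (u2 @ [z + enat n])"
            using u u1 Nil n identify_step.interior[of u2 x _ "[]"] by (simp add: add.commute)
          then show ?thesis using u u1 1(2) by (intro exI[of _ u2] exI[of _ n]) auto
        next
          case (Cons w v')
          have "\<forall>z. identify_step (u @ [z]) ((u2 @ [x + w] @ v') @ [z + enat 0])"
            using u u1 Cons identify_step.interior[of u2 x w "v' @ [_]"]
            by (simp flip: zero_enat_def)
          moreover have "x + w \<noteq> \<infinity>"
            using 1(2) u u1 Cons by (cases x; cases w) auto
          ultimately show ?thesis
            using u u1 Cons 1(2)
            by (intro exI[of _ "u2 @ [x + w] @ v'"] exI[of _ 0]) auto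
        qed
      qed
      then obtain u' n where u': "length u' < length u" "\<infinity> \<notin> set u'"
        and st: "\<And>z. identify_step (u @ [z]) (u' @ [z + enat n])"
        by blast
      obtain s m where s: "0 \<notin> set s" "\<infinity> \<notin> set s"
        and nf: "\<And>z. z \<noteq> 0 \<Longrightarrow> normal_form (u' @ [z]) = s @ [z + enat m]"
        using 1(1) u' by blast
      have "normal_form (u @ [z]) = s @ [z + enat (n + m)]" if "z \<noteq> 0" for z
        using normal_form_identify_step[OF st, of z] nf[of "z + enat n"] that
        by (simp add: add.assoc)
      with s show ?thesis by blast
    qed
  qed
  with that show ?thesis by blast
qed

text \<open>The larger last stack can be reduced to the smaller one, and no P position has a P
  option.\<close>

lemma P_snoc_unique:
  assumes "0 \<notin> set s" "0 < y" "y < z" "P (s @ [enat y])"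
  shows "\<not> P (s @ [enat z])"
proof -
  have "reduce_stacks (s @ [enat z]) (s @ [enat (z - (z - y))])"
    using assms by (intro last_fin) auto
  moreover have "z - (z - y) = y" using assms by simp
  ultimately show ?thesis
    using assms P_iff[of "s @ [enat z]"] normal_form_nonzero[of "s @ [enat y]"]
    by (auto simp: zero_enat_def)
qed

text \<open>A move that touches the prefix takes at most \<open>M\<close> tiles from the last stack,
  with \<open>k = 0\<close> if it leaves that stack alone. The range of \<open>(u, k)\<close> is
  therefore finite and independent of \<open>y\<close>.\<close>

lemma reduce_stacks_snoc:
  assumes "reduce_stacks (s @ [enat y]) r" and "s \<noteq> []" and s: "set s \<subseteq> {..enat M}" and "M < y"
  shows "(\<exists>y'<y. r = s @ [enat y']) \<or>
    (\<exists>u k. set u \<subseteq> {..enat M} \<and> length u = length s \<and> k \<le> M \<and> r = u @ [enat (y - k)])"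
  using assms(1)
proof cases
  case (first_fin k a t)
  then obtain s' where s': "s = enat a # s'" "t = s' @ [enat y]"
    using assms(2) by (cases s) auto
  then have "r = (enat (a - k) # s') @ [enat (y - 0)]" using first_fin(2) by simp
  moreover have "set (enat (a - k) # s') \<subseteq> {..enat M}" "length (enat (a - k) # s') = length s"
    using s s' by auto
  ultimately show ?thesis by blast
next
  case (last_fin k a t)
  then have "r = s @ [enat (y - k)]" "y - k < y" by simp_all
  then show ?thesis by blast
next
  case (fin_fin k a b t v)
  show ?thesis
  proof (cases v rule: rev_cases)
    case Nil
    then have "s @ [enat y] = (t @ [enat a]) @ [enat b]"
      using fin_fin by simp
    then have "s = t @ [enat a]" "b = y"
      by (simp_all only: append1_eq_conv enat.inject)
    then have "r = (t @ [enat (a - k)]) @ [enat (y - k)]" using fin_fin(2) Nil by simp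
    moreover have "set (t @ [enat (a - k)]) \<subseteq> {..enat M}" "length (t @ [enat (a - k)]) = length s"
      "k \<le> M"
      using s fin_fin(4) \<open>s = t @ [enat a]\<close> by auto
    ultimately show ?thesis by blast
  next
    case (snoc v' z)
    then have "s @ [enat y] = (t @ [enat a, enat b] @ v') @ [z]"
      using fin_fin by simp
    then have "s = t @ [enat a, enat b] @ v'" "z = enat y"
      by (simp_all only: append1_eq_conv)
    then have "r = (t @ [enat (a - k), enat (b - k)] @ v') @ [enat (y - 0)]"
      using fin_fin(2) snoc by simp
    moreover have "set (t @ [enat (a - k), enat (b - k)] @ v') \<subseteq> {..enat M}"
      "length (t @ [enat (a - k), enat (b - k)] @ v') = length s"
      using s \<open>s = t @ [enat a, enat b] @ v'\<close> by auto
    ultimately show ?thesis by blast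
  qed
next
  case (first_inf t a)
  have "\<infinity> \<in> set (s @ [enat y])" unfolding first_inf(1) by simp
  then show ?thesis using s by auto
next
  case (inf_inf t v a)
  have "\<infinity> \<in> set (s @ [enat y])" unfolding inf_inf(1) by simp
  then show ?thesis using s by auto
next
  case (inf_fin b' b t v)
  have "\<infinity> \<in> set (s @ [enat y])" unfolding inf_fin(1) by simp
  then show ?thesis using s by auto
next
  case (fin_inf b' b t v)
  have "\<infinity> \<in> set (s @ [enat y])" unfolding fin_inf(1) by simp
  then show ?thesis using s by auto
next
  case (last_inf t a)
  then show ?thesis by simp
qed

lemma P_empty: "P []"
  by (subst P_iff) (auto elim: reduce_stacks.cases)

text \<open>Otherwise every \<open>s @ [enat y]\<close> is an N position.  For \<open>y\<close> above all
  entries of \<open>s\<close>, a winning reply leads to \<open>u @ [enat (y - k)]\<close> with \<open>(u, k)\<close> from a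
  finite set, so two values of \<open>y\<close> share the same \<open>(u, k)\<close>, and the two resulting P
  positions differ only in their last stack.\<close>

lemma snoc_infinite_not_P:
  assumes s0: "0 \<notin> set s" and sinf: "\<infinity> \<notin> set s"
  shows "\<not> P (s @ [\<infinity>])"
proof
  assume "P (s @ [\<infinity>])"
  then have N: "\<not> P (normal_form (s @ [enat y]))" for y
    using P_iff[of "s @ [\<infinity>]"] s0 last_inf by (auto simp: zero_enat_def)
  \<comment> \<open>For empty \<open>s\<close>, reducing the infinite stack to 0 would reach the
    empty position, which is P.\<close>
  have ne: "s \<noteq> []"
    using N[of 0] P_empty by (auto simp: normal_form_def drop_zero_def zero_enat_def)
  obtain M where "Max (insert 0 (set s)) = enat M"
    using sinf Max_in[of "insert 0 (set s)"] by (cases "Max (insert 0 (set s))") auto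
  then have M: "set s \<subseteq> {..enat M}"
    using Max_ge[of "insert 0 (set s)"] by auto
  define U where "U = {u. set u \<subseteq> {..enat M} \<and> length u = length s} \<times> {..M}"
  have "finite U"
    unfolding U_def by (intro finite_cartesian_product finite_lists_length_eq) (auto intro: finite_enat_bounded)
  have "\<exists>w\<in>U. P (normal_form (fst w @ [enat (y - snd w)]))" if "M < y" for y
  proof -
    have "normal_form (s @ [enat y]) = s @ [enat y]"
      using s0 that by (intro normal_form_nonzero) (auto simp: zero_enat_def)
    then have "\<not> P (s @ [enat y])" using N[of y] by simp
    then obtain r where r: "reduce_stacks (s @ [enat y]) r" "P (normal_form r)"
      using P_iff[of "s @ [enat y]"] s0 \<open>M < y\<close> by (auto simp: zero_enat_def)
    \<comment> \<open>A reply that only lowers the last stack leads to another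
      \<open>s @ [enat y']\<close>, which \<open>N\<close> rules out.\<close>
    from reduce_stacks_snoc[OF r(1) ne M that] r(2) N
    obtain u k where "set u \<subseteq> {..enat M}" "length u = length s" "k \<le> M" "r = u @ [enat (y - k)]"
      by blast
    with r(2) show ?thesis
      unfolding U_def by (intro bexI[of _ "(u, k)"]) simp_all
  qed
  then obtain f where f: "\<And>y. M < y \<Longrightarrow> f y \<in> U"
    "\<And>y. M < y \<Longrightarrow> P (normal_form (fst (f y) @ [enat (y - snd (f y))]))"
    by metis
  have "\<not> inj_on f {M<..}"
    using inj_on_finite[of f "{M<..}" U] \<open>finite U\<close> f(1) infinite_Ioi[of M] by blast
  then obtain y z where yz: "M < y" "y < z" "f y = f z"
    unfolding inj_on_def by (metis greaterThan_iff linorder_neqE_nat)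
  obtain u k where uk: "f z = (u, k)" by force
  then have "set u \<subseteq> {..enat M}" "k \<le> M"
    using f(1)[of z] yz by (auto simp: U_def)
  then have "\<infinity> \<notin> set u" by auto
  then obtain t m where t: "0 \<notin> set t"
    and nf: "\<And>z. z \<noteq> 0 \<Longrightarrow> normal_form (u @ [z]) = t @ [z + enat m]"
    by (rule normal_form_snoc) metis
  \<comment> \<open>Since \<open>k \<le> M\<close> and \<open>M < x\<close>, the subtraction is not
    truncated and the last stack stays positive.\<close>
  have "normal_form (u @ [enat (x - k)]) = t @ [enat (x - k + m)]" if "M < x" for x
    using nf[of "enat (x - k)"] that \<open>k \<le> M\<close> by (simp add: enat_0_iff)
  moreover have "P (normal_form (u @ [enat (y - k)]))" "P (normal_form (u @ [enat (z - k)]))"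
    using f(2)[of y] f(2)[of z] yz uk by simp_all
  ultimately have "P (t @ [enat (y - k + m)])" "P (t @ [enat (z - k + m)])"
    using yz by simp_all
  moreover have "0 < y - k + m" "y - k + m < z - k + m"
    using yz \<open>k \<le> M\<close> by simp_all
  ultimately show False
    using P_snoc_unique[OF t, of "y - k + m" "z - k + m"] by metis
qed

text \<open>Zeros are now allowed in \<open>s\<close>, as they arise when the other end is reduced
  to 0; whatever merges into the last stack leaves it infinite.\<close>

lemma last_infinite_not_P: "\<infinity> \<notin> set s \<Longrightarrow> \<not> P (normal_form (s @ [\<infinity>]))"
  by (rule normal_form_snoc[of s]) (auto simp: snoc_infinite_not_P)

lemma first_infinite_not_P:
  assumes "\<infinity> \<notin> set s"
  shows "\<not> P (normal_form (\<infinity> # s))"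
  using last_infinite_not_P[of "rev s"] normal_form_rev[of "\<infinity> # s"] P_rev_iff assms by simp

section \<open>Two infinite ends: only moves that keep both matter\<close>

text \<open>As \<open>s\<close> separates the ends, two adjacent infinite stacks must include an
  entry of \<open>s\<close>; the last disjunct collects this case.\<close>

lemma reduce_stacks_infinite_ends:
  assumes "reduce_stacks (\<infinity> # s @ [\<infinity>]) r" and "s \<noteq> []"
  shows "(\<exists>x. r = enat x # s @ [\<infinity>]) \<or> (\<exists>x. r = \<infinity> # s @ [enat x]) \<or>
    (\<exists>t. r = \<infinity> # t @ [\<infinity>] \<and> length t = length s) \<or> \<infinity> \<in> set s"
  using assms(1)
proof cases
  case (fin_fin k a b t v)
  then obtain t' where t: "t = \<infinity> # t'" by (cases t) auto
  with fin_fin obtain v' where "v = v' @ [\<infinity>]" by (cases v rule: rev_cases) auto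
  with fin_fin t show ?thesis by auto
next
  case (inf_inf t v x)
  show ?thesis
  proof (cases t)
    case Nil
    with inf_inf assms(2) show ?thesis by (cases s) auto
  next
    case (Cons _ t')
    \<comment> \<open>At most one of the two adjacent infinite stacks is the final one, so
      \<open>butlast\<close> keeps the other.\<close>
    with inf_inf have "butlast (s @ [\<infinity>]) = butlast (t' @ \<infinity> # \<infinity> # v)" by simp
    then have "\<infinity> \<in> set s" by (simp add: butlast_append)
    then show ?thesis by simp
  qed
next
  case (inf_fin b' b t v)
  then obtain v' where v: "v = v' @ [\<infinity>]" by (cases v rule: rev_cases) auto
  show ?thesis
  proof (cases t)
    case Nil
    with inf_fin v show ?thesis by auto
  next
    case (Cons _ t')
    with inf_fin v show ?thesis by auto
  qed
next
  case (fin_inf b' b t v)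
  then obtain t' where t: "t = \<infinity> # t'" by (cases t) auto
  show ?thesis
  proof (cases v rule: rev_cases)
    case Nil
    with fin_inf t show ?thesis by auto
  next
    case (snoc v' _)
    with fin_inf t show ?thesis by auto
  qed
qed (use assms(2) in \<open>auto simp: Cons_eq_append_conv\<close>)

lemma P_infinite_ends_iff:
  assumes "s \<noteq> []" "0 \<notin> set s" "\<infinity> \<notin> set s"
  shows "P (\<infinity> # s @ [\<infinity>]) \<longleftrightarrow>
    (\<forall>t. length t = length s \<longrightarrow> reduce_stacks (\<infinity> # s @ [\<infinity>]) (\<infinity> # t @ [\<infinity>]) \<longrightarrow>
      \<not> P (normal_form (\<infinity> # t @ [\<infinity>])))"
proof -
  have "\<not> P (normal_form r)"
    if "r = enat x # s @ [\<infinity>] \<or> r = \<infinity> # s @ [enat x]" for r x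
    using that last_infinite_not_P[of "enat x # s"] first_infinite_not_P[of "s @ [enat x]"] assms(3)
    by auto
  then show ?thesis
    using P_iff[of "\<infinity> # s @ [\<infinity>]"] reduce_stacks_infinite_ends[of s] assms by auto blast
qed

lemma not_P_infinite: "\<not> P [\<infinity>]"
  using snoc_infinite_not_P[of "[]"] by simp

lemma not_P_infinite_infinite: "\<not> P [\<infinity>, \<infinity>]"
  using P_iff[of "[\<infinity>, \<infinity>]"] reduce_stacks.inf_inf[of "[]" "[]" 0] P_empty
  by (auto simp: normal_form_def drop_zero_def zero_enat_def)

section \<open>Moves and normal forms for up to three inner stacks\<close>

lemma reduce_stacks_one:
  "reduce_stacks [\<infinity>, enat a, \<infinity>] [\<infinity>, x, \<infinity>] \<longleftrightarrow> (\<exists>a'<a. x = enat a')"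
proof
  assume "reduce_stacks [\<infinity>, enat a, \<infinity>] [\<infinity>, x, \<infinity>]"
  then show "\<exists>a'<a. x = enat a'"
    by cases (auto simp: Cons_eq_append_conv)
next
  assume "\<exists>a'<a. x = enat a'"
  then show "reduce_stacks [\<infinity>, enat a, \<infinity>] [\<infinity>, x, \<infinity>]"
    using reduce_stacks.inf_fin[of _ a "[]" "[\<infinity>]"] by auto
qed

text \<open>Each inner stack has an infinite neighbour and so can be lowered alone; with the joint
  removal this gives the three kinds of Wythoff move.\<close>

lemma reduce_stacks_two:
  "reduce_stacks [\<infinity>, enat a, enat b, \<infinity>] [\<infinity>, x, y, \<infinity>] \<longleftrightarrow>
    (\<exists>a'<a. x = enat a' \<and> y = enat b) \<or> (\<exists>b'<b. x = enat a \<and> y = enat b') \<or>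
    (\<exists>k>0. k \<le> a \<and> k \<le> b \<and> x = enat (a - k) \<and> y = enat (b - k))" (is "?l \<longleftrightarrow> ?r")
proof
  assume ?l
  then show ?r
    by cases (auto simp: Cons_eq_append_conv)
next
  assume ?r
  then show ?l
    using reduce_stacks.inf_fin[of _ a "[]" "[enat b, \<infinity>]"]
      reduce_stacks.fin_inf[of _ b "[\<infinity>, enat a]" "[]"]
      reduce_stacks.fin_fin[of _ a b "[\<infinity>]" "[\<infinity>]"] by auto
qed

text \<open>The middle stack has no infinite neighbour, so it changes only together with
  \<open>a\<close> or \<open>c\<close>.\<close>

lemma reduce_stacks_three:
  "reduce_stacks [\<infinity>, enat a, enat b, enat c, \<infinity>] [\<infinity>, x, y, z, \<infinity>] \<longleftrightarrow>
    (\<exists>a'<a. x = enat a' \<and> y = enat b \<and> z = enat c) \<or>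
    (\<exists>c'<c. x = enat a \<and> y = enat b \<and> z = enat c') \<or>
    (\<exists>k>0. k \<le> a \<and> k \<le> b \<and> x = enat (a - k) \<and> y = enat (b - k) \<and> z = enat c) \<or>
    (\<exists>k>0. k \<le> b \<and> k \<le> c \<and> x = enat a \<and> y = enat (b - k) \<and> z = enat (c - k))" (is "?l \<longleftrightarrow> ?r")
proof
  assume ?l
  then show ?r
    by cases (auto simp: Cons_eq_append_conv)
next
  assume ?r
  then show ?l
    using reduce_stacks.inf_fin[of _ a "[]" "[enat b, enat c, \<infinity>]"]
      reduce_stacks.fin_inf[of _ c "[\<infinity>, enat a, enat b]" "[]"]
      reduce_stacks.fin_fin[of _ a b "[\<infinity>]" "[enat c, \<infinity>]"]
      reduce_stacks.fin_fin[of _ b c "[\<infinity>, enat a]" "[\<infinity>]"] by auto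
qed

lemma normal_form_one:
  "normal_form [\<infinity>, enat x, \<infinity>] = (if x = 0 then [\<infinity>] else [\<infinity>, enat x, \<infinity>])"
  by (auto simp: normal_form_def drop_zero_def enat_0_iff)

lemma normal_form_two:
  "normal_form [\<infinity>, enat x, enat y, \<infinity>] =
    (if x = 0 \<or> y = 0 then [\<infinity>, \<infinity>] else [\<infinity>, enat x, enat y, \<infinity>])"
  by (auto simp: normal_form_def drop_zero_def enat_0_iff)

text \<open>An empty outer stack merges \<open>y\<close> into the infinite end. If both outer stacks
  were empty, everything would collapse to \<open>[\<infinity>]\<close>; no single move from
  positive stacks empties both.\<close>

lemma normal_form_three:
  assumes "0 < x \<or> 0 < z"
  shows "normal_form [\<infinity>, enat x, enat y, enat z, \<infinity>] =
    (if x = 0 then [\<infinity>, enat z, \<infinity>] else if z = 0 then [\<infinity>, enat x, \<infinity>]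
     else if y = 0 then [\<infinity>, enat (x + z), \<infinity>] else [\<infinity>, enat x, enat y, enat z, \<infinity>])"
  using assms by (auto simp: normal_form_def drop_zero_def enat_0_iff)

lemma all_length_Suc:
  "(\<forall>t. length t = Suc n \<longrightarrow> R t) \<longleftrightarrow> (\<forall>x t. length t = n \<longrightarrow> R (x # t))"
  by (auto simp: length_Suc_conv)

section \<open>Classification for one, two and three inner stacks\<close>

text \<open>From size 1 the only relevant option is \<open>[\<infinity>]\<close>, which is N; every
  larger stack can be reduced to 1.\<close>

lemma P_one_iff:
  assumes "0 < a"
  shows "P [\<infinity>, enat a, \<infinity>] \<longleftrightarrow> a = 1"
proof -
  have *: "P [\<infinity>, enat a, \<infinity>] \<longleftrightarrow> (\<forall>a'<a. \<not> P (normal_form [\<infinity>, enat a', \<infinity>]))" if "0 < a" for a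
    using P_infinite_ends_iff[of "[enat a]"] that
    by (simp add: zero_enat_def all_length_Suc reduce_stacks_one) metis
  have 1: "P [\<infinity>, enat 1, \<infinity>]"
    using not_P_infinite by (subst *) (auto simp: normal_form_one)
  moreover have "\<not> P [\<infinity>, enat a, \<infinity>]" if "1 < a"
    using *[of a] that 1 by (auto simp: normal_form_one)
  ultimately show ?thesis using assms by (cases "a = 1") auto
qed

lemma wythoff_terminates: "wfP (\<lambda>q p. wythoff_move p q)"
proof -
  have "{(q, p). wythoff_move p q} \<subseteq> measure (\<lambda>(x, y). x + y)"
    by (auto elim: wythoff_move.cases)
  then show ?thesis unfolding wfp_def by (rule wf_subset[rotated]) simp
qed

text \<open>Translates between moves given by the resulting size, as in \<open>inf_fin\<close>, and
  moves given by the number of tiles removed, as in \<open>wythoff_move\<close>.\<close>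

lemma all_less_iff_all_diff:
  fixes x :: nat
  shows "(\<forall>a<x. R a) \<longleftrightarrow> (\<forall>k>0. k \<le> x \<longrightarrow> R (x - k))"
proof (intro iffI allI impI)
  fix a assume "\<forall>k>0. k \<le> x \<longrightarrow> R (x - k)" "a < x"
  then show "R a" by (metis diff_diff_cancel diff_le_self less_imp_le zero_less_diff)
qed simp

lemma P_two_iff:
  "P [\<infinity>, enat (Suc x), enat (Suc y), \<infinity>] \<longleftrightarrow> p_position wythoff_move (x, y)"
proof (induction "x + y" arbitrary: x y rule: less_induct)
  case less
  let ?Q = "\<lambda>a b. P (normal_form [\<infinity>, enat a, enat b, \<infinity>])"
  let ?W = "\<lambda>x y. p_position wythoff_move (x, y)"
  \<comment> \<open>An emptied stack yields \<open>[\<infinity>, \<infinity>]\<close>, which is N;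
    otherwise the induction hypothesis applies.\<close>
  have Q: "?Q a b \<longleftrightarrow> 0 < a \<and> 0 < b \<and> ?W (a - 1) (b - 1)" if "a + b < Suc x + Suc y" for a b
    using less[of "a - 1" "b - 1"] that by (auto simp: normal_form_two not_P_infinite_infinite)
  have "P [\<infinity>, enat (Suc x), enat (Suc y), \<infinity>] \<longleftrightarrow>
     (\<forall>u v. reduce_stacks [\<infinity>, enat (Suc x), enat (Suc y), \<infinity>] [\<infinity>, u, v, \<infinity>] \<longrightarrow>
       \<not> P (normal_form [\<infinity>, u, v, \<infinity>]))"
    using P_infinite_ends_iff[of "[enat (Suc x), enat (Suc y)]"]
    by (simp add: zero_enat_def all_length_Suc)
  also have "\<dots> \<longleftrightarrow>
     (\<forall>a<Suc x. \<not> ?Q a (Suc y)) \<and> (\<forall>b<Suc y. \<not> ?Q (Suc x) b) \<and>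
     (\<forall>k>0. k \<le> Suc x \<and> k \<le> Suc y \<longrightarrow> \<not> ?Q (Suc x - k) (Suc y - k))"
    unfolding reduce_stacks_two by (intro iffI conjI; blast)
  also have "\<dots> \<longleftrightarrow> (\<forall>k>0. k \<le> x \<longrightarrow> \<not> ?W (x - k) y) \<and> (\<forall>k>0. k \<le> y \<longrightarrow> \<not> ?W x (y - k)) \<and>
     (\<forall>k>0. k \<le> x \<and> k \<le> y \<longrightarrow> \<not> ?W (x - k) (y - k))"
  proof -
    \<comment> \<open>The extra removal \<open>k = Suc x\<close> empties the stack and never reaches
      a P position, so exactly the Wythoff range \<open>k \<le> x\<close> remains.\<close>
    have 1: "?Q (Suc x - k) (Suc y) \<longleftrightarrow> k \<le> x \<and> ?W (x - k) y" if "0 < k" for k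
      using that Q[of "Suc x - k" "Suc y"] by (cases "k \<le> x") (simp_all add: Suc_diff_le)
    have 2: "?Q (Suc x) (Suc y - k) \<longleftrightarrow> k \<le> y \<and> ?W x (y - k)" if "0 < k" for k
      using that Q[of "Suc x" "Suc y - k"] by (cases "k \<le> y") (simp_all add: Suc_diff_le)
    have 3: "?Q (Suc x - k) (Suc y - k) \<longleftrightarrow> k \<le> x \<and> k \<le> y \<and> ?W (x - k) (y - k)" if "0 < k" for k
      using that Q[of "Suc x - k" "Suc y - k"]
      by (cases "k \<le> x"; cases "k \<le> y") (simp_all add: Suc_diff_le)
    have "(\<forall>a<Suc x. \<not> ?Q a (Suc y)) \<longleftrightarrow> (\<forall>k>0. k \<le> x \<longrightarrow> \<not> ?W (x - k) y)"
      unfolding all_less_iff_all_diff[of "Suc x"] using 1 le_SucI by blast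
    moreover have "(\<forall>b<Suc y. \<not> ?Q (Suc x) b) \<longleftrightarrow> (\<forall>k>0. k \<le> y \<longrightarrow> \<not> ?W x (y - k))"
      unfolding all_less_iff_all_diff[of "Suc y"] using 2 le_SucI by blast
    moreover have "(\<forall>k>0. k \<le> Suc x \<and> k \<le> Suc y \<longrightarrow> \<not> ?Q (Suc x - k) (Suc y - k)) \<longleftrightarrow>
      (\<forall>k>0. k \<le> x \<and> k \<le> y \<longrightarrow> \<not> ?W (x - k) (y - k))"
      using 3 le_SucI by blast
    ultimately show ?thesis by simp
  qed
  also have "\<dots> \<longleftrightarrow> (\<forall>q. wythoff_move (x, y) q \<longrightarrow> \<not> p_position wythoff_move q)"
    by (auto elim!: wythoff_move.cases intro: wythoff_move.intros)
  also have "\<dots> \<longleftrightarrow> ?W x y"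
    using p_position_iff[OF wythoff_terminates] by metis
  finally show ?case .
qed

lemma P_three_iff:
  assumes "0 < a" "0 < b" "0 < c"
  shows "P [\<infinity>, enat a, enat b, enat c, \<infinity>] \<longleftrightarrow> a = c \<and> 1 < c"
  using assms
proof (induction "a + b + c" arbitrary: a b c rule: less_induct)
  case less
  let ?Q = "\<lambda>a b c. P (normal_form [\<infinity>, enat a, enat b, enat c, \<infinity>])"
  \<comment> \<open>If only the middle stack is emptied, the outer ones merge into a stack of size
    at least 2, which is N; hence \<open>y \<noteq> 0\<close>.\<close>
  have Q: "?Q x y z \<longleftrightarrow> (if x = 0 then z = 1 else if z = 0 then x = 1 else y \<noteq> 0 \<and> x = z \<and> 1 < z)"
    if "x + y + z < a + b + c" "0 < x \<or> 0 < z" for x y z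
    using less(1)[of x y z] that P_one_iff by (auto simp: normal_form_three)
  have "P [\<infinity>, enat a, enat b, enat c, \<infinity>] \<longleftrightarrow>
     (\<forall>x y z. reduce_stacks [\<infinity>, enat a, enat b, enat c, \<infinity>] [\<infinity>, x, y, z, \<infinity>] \<longrightarrow>
       \<not> P (normal_form [\<infinity>, x, y, z, \<infinity>]))"
    using P_infinite_ends_iff[of "[enat a, enat b, enat c]"] less.prems
    by (simp add: zero_enat_def all_length_Suc)
  also have "\<dots> \<longleftrightarrow>
     (\<forall>a'<a. \<not> ?Q a' b c) \<and> (\<forall>c'<c. \<not> ?Q a b c') \<and>
     (\<forall>k>0. k \<le> a \<and> k \<le> b \<longrightarrow> \<not> ?Q (a - k) (b - k) c) \<and>
     (\<forall>k>0. k \<le> b \<and> k \<le> c \<longrightarrow> \<not> ?Q a (b - k) (c - k))"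
    unfolding reduce_stacks_three by (intro iffI conjI; blast)
  also have "\<dots> \<longleftrightarrow> a = c \<and> 1 < c" (is "?l \<longleftrightarrow> ?r")
  proof
    assume l: ?l
    then have "\<not> ?Q 0 b c" "\<not> ?Q a b 0"
      using less.prems by auto
    \<comment> \<open>Emptying one outer stack leaves the other between the infinite ends, a P
      position if its size is 1.\<close>
    then have "a \<noteq> 1" "c \<noteq> 1"
      using Q[of 0 b c] Q[of a b 0] less.prems by auto
    \<comment> \<open>If \<open>a\<close> and \<open>c\<close> differ, lowering the larger to the
      smaller gives equal outer stacks above 1, which are P by induction.\<close>
    then show ?r
      using l Q[of a b a] Q[of c b c] less.prems
      by (cases a c rule: linorder_cases) auto
  next
    assume ?r
    \<comment> \<open>Every remaining move changes exactly one outer stack, so equality is lost; if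
      that stack is emptied, the other still exceeds 1.\<close>
    then show ?l
      using less.prems by (auto simp: Q)
  qed
  finally show ?case .
qed

theorem theorem21:
  fixes a b c :: nat
  assumes "a > 0" and "b > 0" and "c > 0"
  shows "(p_position twyst_off_move [\<infinity>, enat a, \<infinity>] \<longleftrightarrow> a = 1) \<and>
    (p_position twyst_off_move [\<infinity>, enat a, enat b, \<infinity>] \<longleftrightarrow>
      (\<exists>x y. (a, b) = (x + 1, y + 1) \<and> p_position wythoff_move (x, y))) \<and>
    (p_position twyst_off_move [\<infinity>, enat a, enat b, enat c, \<infinity>] \<longleftrightarrow> a = c \<and> c > 1)"
  using assms P_one_iff[of a] P_two_iff[of "a - 1" "b - 1"] P_three_iff[of a b c]
  by (auto simp: gr0_conv_Suc)

end
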